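(* Let $m \in \mathds{N}$. Then $P_m$ is a prime ideal of $\mathcal{A}$.
   Context: $\mathds{N}$ denotes the non-negative integers and $\mathds{N}^+=\mathds{N}\setminus\{0\}$. $\mathcal{A}$ is the ring of arithmetical functions: the set of all functions $f\colon \mathds{N}^+\to\mathds{C}$ with pointwise addition $(f+g)(n)=f(n)+g(n)$ and Dirichlet convolution $(f*g)(n)=\sum_{ij=n}f(i)g(j)$ as multiplication. It is a commutative ring with identity $e$, where $e(1)=1$ and $e(n)=0$ for $n>1$. For $m\in\mathds{N}$, $P_m := \{f\in\mathcal{A} \mid f(n)=0 \text{ for all } n\in\mathds{N}^+ \text{ with } \gcd(m,n)=1\}$ (with $\gcd(0,n)=n$). *)

theory Defs
  imports Complex_Main "HOL-Library.FuncSet" "HOL-Algebra.Ideal"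
begin

text \<open>
  Arithmetical functions are extensional functions on the positive integers, so two elements
  of the carrier are equal iff they agree at every \<open>n > 0\<close>.
  For \<open>n > 0\<close> the index set of the convolution sum is finite and contains only pairs of
  positive integers.
\<close>

definition arith_ring :: "(nat \<Rightarrow> complex) ring" where
  "arith_ring =
    \<lparr>carrier = {0<..} \<rightarrow>\<^sub>E UNIV,
     mult = (\<lambda>f g. \<lambda>n\<in>{0<..}. \<Sum>(i, j)\<in>{(i, j). i * j = n}. f i * g j),
     one = (\<lambda>n\<in>{0<..}. if n = 1 then 1 else 0),
     zero = (\<lambda>n\<in>{0<..}. 0),
     add = (\<lambda>f g. \<lambda>n\<in>{0<..}. f n + g n)\<rparr>"

definition arith_P :: "nat \<Rightarrow> (nat \<Rightarrow> complex) set" where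
  "arith_P m = {f \<in> carrier arith_ring. \<forall>n>0. gcd m n = 1 \<longrightarrow> f n = 0}"

end

theory Submission
  imports Defs
begin

text \<open>
  The set \<open>C\<close> of positive integers coprime to \<open>m\<close> is closed both under products and under passing
  to divisors. Closure under divisors makes \<open>arith_P m\<close> an ideal: at \<open>n \<in> C\<close> every term of the
  convolution sum evaluates both factors inside \<open>C\<close>. Closure under products makes it
  prime: if \<open>a\<close> and \<open>b\<close> are the least elements of \<open>C\<close> at which \<open>f\<close> and \<open>g\<close> do not vanish, then in
  the sum for \<open>(f * g) (a b)\<close> every factorisation \<open>i j = a b\<close> other than \<open>(a, b)\<close> has \<open>i < a\<close> or
  \<open>j < b\<close>. As \<open>i, j \<in> C\<close>, its term vanishes, so \<open>(f * g) (a b) = f a * g b \<noteq> 0\<close>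
  with \<open>a b \<in> C\<close>.

  Among the ring axioms the substantial one is the associativity of Dirichlet convolution,
  which holds because both bracketings sum \<open>f i * g j * h l\<close> over all triples with \<open>i j l = n\<close>.
\<close>

lemma finite_factorizations:
  assumes "n > 0"
  shows "finite {(i, j). i * j = (n::nat)}"
proof (rule finite_subset)
  show "{(i, j). i * j = n} \<subseteq> {..n} \<times> {..n}"
    using assms by (auto simp: Suc_le_eq)
qed auto

lemma carrier_arith_ring: "carrier arith_ring = {0<..} \<rightarrow>\<^sub>E UNIV"
  and zero_arith_ring: "n > 0 \<Longrightarrow> \<zero>\<^bsub>arith_ring\<^esub> n = 0"
  and one_arith_ring: "n > 0 \<Longrightarrow> \<one>\<^bsub>arith_ring\<^esub> n = (if n = 1 then 1 else 0)"
  and add_arith_ring: "n > 0 \<Longrightarrow> (f \<oplus>\<^bsub>arith_ring\<^esub> g) n = f n + g n"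
  and mult_arith_ring:
    "n > 0 \<Longrightarrow> (f \<otimes>\<^bsub>arith_ring\<^esub> g) n = (\<Sum>(i, j)\<in>{(i, j). i * j = n}. f i * g j)"
  by (simp_all add: arith_ring_def)

lemmas arith_ring_simps =
  zero_arith_ring one_arith_ring add_arith_ring mult_arith_ring

lemma arith_ring_closed:
  "\<zero>\<^bsub>arith_ring\<^esub> \<in> carrier arith_ring" "\<one>\<^bsub>arith_ring\<^esub> \<in> carrier arith_ring"
  "f \<oplus>\<^bsub>arith_ring\<^esub> g \<in> carrier arith_ring" "f \<otimes>\<^bsub>arith_ring\<^esub> g \<in> carrier arith_ring"
  by (auto simp: arith_ring_def)

lemma arith_ring_ext:
  assumes "f \<in> carrier arith_ring" "g \<in> carrier arith_ring" "\<And>n. n > 0 \<Longrightarrow> f n = g n"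
  shows "f = g"
  using assms by (auto simp: carrier_arith_ring intro: PiE_ext)

lemma convolution_assoc:
  fixes f g h :: "nat \<Rightarrow> complex"
  assumes "n > 0"
  shows "(f \<otimes>\<^bsub>arith_ring\<^esub> g \<otimes>\<^bsub>arith_ring\<^esub> h) n = (f \<otimes>\<^bsub>arith_ring\<^esub> (g \<otimes>\<^bsub>arith_ring\<^esub> h)) n"
proof -
  let ?D = "\<lambda>n. {(i::nat, j::nat). i * j = n}"
  have fin: "finite (?D k)" "finite (?D l)" if "(k, l) \<in> ?D n" for k l
    using that assms by (auto intro!: finite_factorizations)
  have "(f \<otimes>\<^bsub>arith_ring\<^esub> g \<otimes>\<^bsub>arith_ring\<^esub> h) n
      = (\<Sum>p\<in>?D n. \<Sum>q\<in>?D (fst p). f (fst q) * g (snd q) * h (snd p))"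
    unfolding mult_arith_ring[OF assms] using assms
    by (intro sum.cong) (auto simp: mult_arith_ring sum_distrib_right case_prod_unfold)
  also have "\<dots> = (\<Sum>(p, q)\<in>(SIGMA p:?D n. ?D (fst p)). f (fst q) * g (snd q) * h (snd p))"
    using fin finite_factorizations[OF assms] by (intro sum.Sigma) auto
  also have "\<dots> = (\<Sum>(p, q)\<in>(SIGMA p:?D n. ?D (snd p)). f (fst p) * (g (fst q) * h (snd q)))"
    \<comment> \<open>Both sides are indexed by triples: \<open>((i j, l), (i, j))\<close> corresponds to \<open>((i, j l), (j, l))\<close>.\<close>
    by (rule sum.reindex_bij_witness[where
          i = "\<lambda>((i, k), (j, l)). ((i * j, l), (i, j))" and
          j = "\<lambda>((k, l), (i, j)). ((i, j * l), (j, l))"]) (auto simp: mult.assoc)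
  also have "\<dots> = (\<Sum>p\<in>?D n. \<Sum>q\<in>?D (snd p). f (fst p) * (g (fst q) * h (snd q)))"
    using fin finite_factorizations[OF assms] by (intro sum.Sigma[symmetric]) auto
  also have "\<dots> = (f \<otimes>\<^bsub>arith_ring\<^esub> (g \<otimes>\<^bsub>arith_ring\<^esub> h)) n"
    unfolding mult_arith_ring[OF assms] using assms
    by (intro sum.cong) (auto simp: mult_arith_ring sum_distrib_left case_prod_unfold)
  finally show ?thesis .
qed

lemma convolution_commute:
  assumes "n > 0"
  shows "(f \<otimes>\<^bsub>arith_ring\<^esub> g) n = (g \<otimes>\<^bsub>arith_ring\<^esub> f) n"
  unfolding mult_arith_ring[OF assms]
  by (rule sum.reindex_bij_witness[where i = prod.swap and j = prod.swap])
    (auto simp: mult.commute)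

text \<open>Only the factorisation \<open>(1, n)\<close> meets the support of the unit.\<close>

lemma convolution_one_left:
  assumes "n > 0"
  shows "(\<one>\<^bsub>arith_ring\<^esub> \<otimes>\<^bsub>arith_ring\<^esub> f) n = f n"
proof -
  have "(\<one>\<^bsub>arith_ring\<^esub> \<otimes>\<^bsub>arith_ring\<^esub> f) n = (\<Sum>(i, j)\<in>{(1, n)}. \<one>\<^bsub>arith_ring\<^esub> i * f j)"
    unfolding mult_arith_ring[OF assms] using assms finite_factorizations[OF assms]
    by (intro sum.mono_neutral_right) (auto simp: one_arith_ring split: if_splits)
  then show ?thesis by (simp add: one_arith_ring)
qed

lemma convolution_distrib:
  assumes "n > 0"
  shows "((f \<oplus>\<^bsub>arith_ring\<^esub> g) \<otimes>\<^bsub>arith_ring\<^esub> h) n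
    = (f \<otimes>\<^bsub>arith_ring\<^esub> h) n + (g \<otimes>\<^bsub>arith_ring\<^esub> h) n"
  unfolding mult_arith_ring[OF assms] sum.distrib[symmetric] using assms
  by (intro sum.cong) (auto simp: add_arith_ring distrib_right)

lemma cring_arith_ring: "cring arith_ring"
proof (rule cringI)
  show "abelian_group arith_ring"
  proof (rule abelian_groupI)
    fix f assume "f \<in> carrier arith_ring"
    show "\<exists>g\<in>carrier arith_ring. g \<oplus>\<^bsub>arith_ring\<^esub> f = \<zero>\<^bsub>arith_ring\<^esub>"
      by (rule bexI[of _ "\<lambda>n\<in>{0<..}. - f n"])
        (auto intro!: arith_ring_ext arith_ring_closed simp: arith_ring_simps carrier_arith_ring)
  qed (auto intro!: arith_ring_ext simp: arith_ring_closed arith_ring_simps)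
  show "comm_monoid arith_ring"
    by (rule comm_monoidI)
      (auto intro!: arith_ring_ext convolution_assoc convolution_commute convolution_one_left
        simp: arith_ring_closed)
  show "(f \<oplus>\<^bsub>arith_ring\<^esub> g) \<otimes>\<^bsub>arith_ring\<^esub> h
      = f \<otimes>\<^bsub>arith_ring\<^esub> h \<oplus>\<^bsub>arith_ring\<^esub> g \<otimes>\<^bsub>arith_ring\<^esub> h" for f g h
    by (rule arith_ring_ext)
      (auto intro!: arith_ring_closed simp: convolution_distrib add_arith_ring)
qed

lemma in_arith_P_iff:
  "f \<in> arith_P m \<longleftrightarrow> f \<in> carrier arith_ring \<and> (\<forall>n>0. coprime m n \<longrightarrow> f n = 0)"
  by (simp add: arith_P_def coprime_iff_gcd_eq_1)

lemma arith_P_mult_closed: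
  assumes "f \<in> arith_P m"
  shows "f \<otimes>\<^bsub>arith_ring\<^esub> g \<in> arith_P m"
proof -
  have "(f \<otimes>\<^bsub>arith_ring\<^esub> g) n = 0" if n: "n > 0" "coprime m n" for n
    unfolding mult_arith_ring[OF n(1)]
  proof (rule sum.neutral, clarify)
    fix i j assume "n = i * j"
    with n have "i > 0" "coprime m i"
      by auto
    with assms have "f i = 0" by (simp add: in_arith_P_iff)
    then show "f i * g j = 0" by simp
  qed
  then show ?thesis by (simp add: in_arith_P_iff arith_ring_closed)
qed

lemma ideal_arith_P: "ideal (arith_P m) arith_ring"
proof -
  interpret cring arith_ring by (rule cring_arith_ring)
  show ?thesis
  proof (rule idealI)
    show "subgroup (arith_P m) (add_monoid arith_ring)"
    proof (rule add.subgroupI)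
      fix f assume f: "f \<in> arith_P m"
      then have fc: "f \<in> carrier arith_ring" by (simp add: in_arith_P_iff)
      \<comment> \<open>Negation is multiplication by \<open>-1\<close>, so closure under products suffices.\<close>
      have "\<ominus>\<^bsub>arith_ring\<^esub> f = (\<ominus>\<^bsub>arith_ring\<^esub> \<one>\<^bsub>arith_ring\<^esub>) \<otimes>\<^bsub>arith_ring\<^esub> f"
        using fc by (simp add: l_minus)
      also have "\<dots> = f \<otimes>\<^bsub>arith_ring\<^esub> (\<ominus>\<^bsub>arith_ring\<^esub> \<one>\<^bsub>arith_ring\<^esub>)"
        using fc by (simp add: m_comm)
      finally show "\<ominus>\<^bsub>arith_ring\<^esub> f \<in> arith_P m"
        using arith_P_mult_closed[OF f] by simp
    next
      have "\<zero>\<^bsub>arith_ring\<^esub> \<in> arith_P m" by (simp add: in_arith_P_iff zero_arith_ring)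
      then show "arith_P m \<noteq> {}" by blast
    qed (auto simp: in_arith_P_iff add_arith_ring)
    show "ring arith_ring" by (rule ring_axioms)
    fix f g assume f: "f \<in> arith_P m" and g: "g \<in> carrier arith_ring"
    show "f \<otimes>\<^bsub>arith_ring\<^esub> g \<in> arith_P m" by (rule arith_P_mult_closed[OF f])
    moreover have "f \<in> carrier arith_ring" using f by (simp add: in_arith_P_iff)
    ultimately show "g \<otimes>\<^bsub>arith_ring\<^esub> f \<in> arith_P m" using g by (simp add: m_comm)
  qed
qed

lemma not_in_arith_P_least:
  assumes "f \<in> carrier arith_ring" "f \<notin> arith_P m"
  obtains a where "a > 0" "coprime m a" "f a \<noteq> 0"
    "\<And>i. i > 0 \<Longrightarrow> coprime m i \<Longrightarrow> i < a \<Longrightarrow> f i = 0"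
proof -
  let ?P = "\<lambda>n. n > 0 \<and> coprime m n \<and> f n \<noteq> 0"
  from assms have "\<exists>n. ?P n" by (auto simp: in_arith_P_iff)
  then have "?P (LEAST n. ?P n)" by (rule LeastI_ex)
  moreover have "\<not> ?P i" if "i < (LEAST n. ?P n)" for i
    using that by (rule not_less_Least)
  ultimately show thesis by (intro that[of "LEAST n. ?P n"]) blast+
qed

text \<open>
  The classical argument that a product of nonzero Dirichlet series is nonzero, applied to the part
  supported on the integers coprime to \<open>m\<close>: the leading terms multiply without interference.
\<close>

lemma arith_P_prime:
  assumes f: "f \<in> carrier arith_ring" "f \<notin> arith_P m"
    and g: "g \<in> carrier arith_ring" "g \<notin> arith_P m"
  shows "f \<otimes>\<^bsub>arith_ring\<^esub> g \<notin> arith_P m"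
proof -
  obtain a where a: "a > 0" "coprime m a" "f a \<noteq> 0"
      "\<And>i. i > 0 \<Longrightarrow> coprime m i \<Longrightarrow> i < a \<Longrightarrow> f i = 0"
    using not_in_arith_P_least[OF f] by blast
  obtain b where b: "b > 0" "coprime m b" "g b \<noteq> 0"
      "\<And>j. j > 0 \<Longrightarrow> coprime m j \<Longrightarrow> j < b \<Longrightarrow> g j = 0"
    using not_in_arith_P_least[OF g] by blast
  have pos: "a * b > 0" using a(1) b(1) by simp
  have cop: "coprime m (a * b)"
    using a(2) b(2) by simp
  have vanish: "f i * g j = 0" if ij: "i * j = a * b" "(i, j) \<noteq> (a, b)" for i j
  proof -
    from pos have ij0: "i > 0" "j > 0" by (auto simp: ij(1)[symmetric])
    have "coprime m (i * j)" using cop by (simp add: ij(1))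
    then have ijm: "coprime m i" "coprime m j" by auto
    \<comment> \<open>If \<open>a \<le> i\<close> and \<open>b \<le> j\<close>, then equality of the products forces equality of the pairs.\<close>
    have "i < a \<or> j < b"
    proof (rule ccontr)
      assume "\<not> (i < a \<or> j < b)"
      then have le: "a \<le> i" "b \<le> j" by auto
      have "a * b \<le> a * j" "a * j \<le> i * j" using le by auto
      with ij(1) have "a * j = a * b" "i * j = a * j" by auto
      with a(1) ij0 ij(2) show False by simp
    qed
    then show ?thesis using a(4) b(4) ij0 ijm by auto
  qed
  have "(f \<otimes>\<^bsub>arith_ring\<^esub> g) (a * b) = (\<Sum>(i, j)\<in>{(a, b)}. f i * g j)"
    unfolding mult_arith_ring[OF pos]
  proof (rule sum.mono_neutral_right)
    show "finite {(i, j). i * j = a * b}" by (rule finite_factorizations[OF pos])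
    show "{(a, b)} \<subseteq> {(i, j). i * j = a * b}" by simp
    show "\<forall>p\<in>{(i, j). i * j = a * b} - {(a, b)}. (case p of (i, j) \<Rightarrow> f i * g j) = 0"
      using vanish by (auto simp del: mult_eq_0_iff)
  qed
  then have "(f \<otimes>\<^bsub>arith_ring\<^esub> g) (a * b) \<noteq> 0" using a(3) b(3) by simp
  then show ?thesis using pos cop unfolding in_arith_P_iff by blast
qed

theorem corollary3p13:
  fixes m :: nat
  shows "primeideal (arith_P m) arith_ring"
proof (rule primeidealI)
  show "ideal (arith_P m) arith_ring" by (rule ideal_arith_P)
  show "cring arith_ring" by (rule cring_arith_ring)
  \<comment> \<open>The unit does not vanish at \<open>1\<close>, which is coprime even to \<open>m = 0\<close>.\<close>
  have "\<one>\<^bsub>arith_ring\<^esub> \<notin> arith_P m"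
    by (auto simp: in_arith_P_iff one_arith_ring intro!: exI[of _ 1])
  then show "carrier arith_ring \<noteq> arith_P m" using arith_ring_closed(2) by blast
  show "f \<in> arith_P m \<or> g \<in> arith_P m"
    if "f \<in> carrier arith_ring" "g \<in> carrier arith_ring" "f \<otimes>\<^bsub>arith_ring\<^esub> g \<in> arith_P m" for f g
    using that arith_P_prime by blast
qed

end
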